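(* The closure of $D_2$ is \[\overline{D_2}=\left[\frac{6}{\pi^2},\frac{2}{3}\right]\cup\left[\frac{27}{4\pi^2},\frac{3}{4}\right]\cup\left[\frac{8}{\pi^2},\frac{8}{9}\right]\cup\left[\frac{9}{\pi^2},1\right].\]
   Context: $D_2=\left\{\prod_{p\mid b}\left(1-\frac{1}{p^2}\right): b\in\mathbb{Z}\right\}$, where the product is over primes dividing $b$ (for $b=0$ it is the product over all primes, equal to $1/\zeta(2)=6/\pi^2$). *)

theory Defs
  imports "HOL-Analysis.Analysis" "HOL-Computational_Algebra.Primes"
begin

text \<open>
  The product over the primes dividing \<open>b\<close> is an infinite product over all naturals whose
  factors other than those primes are \<open>1\<close>. For \<open>b = 0\<close> it runs over all primes; for
  \<open>b \<noteq> 0\<close> it is the finite product (lemma \<open>prime_divisor_prod_nonzero\<close>).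
  The infinite product always converges (lemma \<open>convergent_prime_divisor_prod\<close>).
\<close>

definition prime_divisor_prod :: "int \<Rightarrow> real" where
  "prime_divisor_prod b =
     (\<Prod>p. if prime p \<and> int p dvd b then 1 - 1 / (real p)^2 else 1)"

definition D2 :: "real set" where
  "D2 = {prime_divisor_prod b | b. True}"

lemma convergent_prime_divisor_prod:
  "convergent_prod (\<lambda>p. if prime p \<and> int p dvd b then 1 - 1 / (real p)^2 else 1)"
proof -
  let ?f = "\<lambda>p. if prime p \<and> int p dvd b then 1 - 1 / (real p)^2 else 1"
  have "summable (\<lambda>p. norm (?f p - 1))"
  proof (rule summable_comparison_test')
    show "summable (\<lambda>p. 1 / (real p)^2)"
      using inverse_power_summable[of 2, where 'a=real] by (simp add: field_simps)
    show "norm (norm (?f p - 1)) \<le> 1 / (real p)^2" if "p \<ge> 0" for p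
      by auto
  qed
  then show ?thesis
    by (intro abs_convergent_prod_imp_convergent_prod summable_imp_abs_convergent_prod)
qed

lemma prime_divisor_prod_nonzero:
  assumes "b \<noteq> 0"
  shows "prime_divisor_prod b = (\<Prod>p | prime p \<and> int p dvd b. 1 - 1 / (real p)^2)"
proof -
  have fin: "finite {p. prime p \<and> int p dvd b}"
  proof (rule finite_subset)
    show "{p. prime p \<and> int p dvd b} \<subseteq> {..nat \<bar>b\<bar>}"
    proof
      fix p assume "p \<in> {p. prime p \<and> int p dvd b}"
      then have "\<bar>int p\<bar> \<le> \<bar>b\<bar>"
        using assms by (intro dvd_imp_le_int) simp_all
      then show "p \<in> {..nat \<bar>b\<bar>}"
        by simp
    qed
  qed simp
  have "prime_divisor_prod b = (\<Prod>p | prime p \<and> int p dvd b.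
      if prime p \<and> int p dvd b then 1 - 1 / (real p)^2 else 1)"
    unfolding prime_divisor_prod_def by (rule prodinf_finite[OF fin]) auto
  also have "\<dots> = (\<Prod>p | prime p \<and> int p dvd b. 1 - 1 / (real p)^2)"
    by (rule prod.cong) simp_all
  finally show ?thesis .
qed

end

theory Submission
  imports Defs
begin

text \<open>
  Fixing which of the primes 2 and 3 divide \<open>b\<close> contributes a factor 1, 3/4, 8/9 or 2/3, so
  everything reduces to the products over sets of primes \<open>\<ge> 5\<close>, whose infimum is
  \<open>(6 / \<pi>\<^sup>2) / (2 / 3) = 9 / \<pi>\<^sup>2\<close>. They are dense in \<open>[9 / \<pi>\<^sup>2, 1]\<close> by the greedy algorithm, which
  never leaves a gap because \<open>\<Prod>q>p. (1 - 1/q\<^sup>2) \<le> 1 - 1/p\<^sup>2\<close> for all primes \<open>p \<ge> 5\<close>. This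
  inequality holds as soon as some interval \<open>(p, m]\<close> contains at least \<open>m\<^sup>2 / (p\<^sup>2 - 1)\<close> primes. For
  \<open>p \<ge> 841\<close> one takes \<open>m = p \<lfloor>\<surd>p\<rfloor>\<close> and uses a Chebyshev lower bound for the number of primes
  up to \<open>m\<close>; smaller \<open>p\<close> are settled by a short list of explicit primes.
\<close>

subsection \<open>A Chebyshev bound\<close>

text \<open>
  Nair's divisibility, via the recurrence of Leibniz's harmonic triangle: the numbers
  \<open>a n m = m * (n choose m)\<close> satisfy \<open>1 / a (n + 1) m = 1 / a n m - 1 / a (n + 1) (m + 1)\<close>,
  so the quotients of \<open>d\<close> by them stay integral.
\<close>

lemma times_binomial_dvd:
  fixes d :: nat
  assumes "\<And>j. 1 \<le> j \<Longrightarrow> j \<le> n \<Longrightarrow> j dvd d" and "1 \<le> m" and "m \<le> n"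
  shows "m * (n choose m) dvd d"
  using assms
proof (induction n arbitrary: m)
  case 0
  then show ?case by simp
next
  case (Suc n)
  from Suc.prems(3) Suc.prems(2) show ?case
  \<comment> \<open>Row \<open>Suc n\<close> is treated from its last entry \<open>m = Suc n\<close>
    downwards: each entry follows from the entry of row \<open>n\<close> in the same column and from
    its right neighbour.\<close>
  proof (induction m rule: inc_induct)
    case base
    then show ?case using Suc.prems(1) by simp
  next
    case (step m)
    let ?B = "n choose m" and ?C = "Suc n choose m"
    have "m * ?B dvd d" using Suc.IH[of m] Suc.prems(1) step by simp
    then obtain k1 where k1: "d = m * ?B * k1" by blast
    have "Suc m * (Suc n choose Suc m) dvd d" using step by simp
    then obtain k2 where k2: "d = Suc n * ?B * k2"
      unfolding Suc_times_binomial by blast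
    have C: "(Suc n - m) * ?C = Suc n * ?B"
      using binomial_absorb_comp[of "Suc n" m] by simp
    \<comment> \<open>In the integers the quotients \<open>k1\<close> and \<open>k2\<close> can be
      subtracted; the factor \<open>Suc n - m\<close>, nonzero because \<open>m < Suc n\<close>, is
      cancelled afterwards.\<close>
    have "int (Suc n - m) * int d = int (Suc n) * int d - int m * int d"
      using step by (simp add: of_nat_diff algebra_simps)
    also have "\<dots> = int m * (int (Suc n) * int ?B) * (int k1 - int k2)"
    proof -
      have "int d = int m * int ?B * int k1" and "int d = int (Suc n) * int ?B * int k2"
        by (metis k1 of_nat_mult, metis k2 of_nat_mult)
      then have "int (Suc n) * int d - int m * int d =
          int (Suc n) * (int m * int ?B * int k1) - int m * (int (Suc n) * int ?B * int k2)"
        by metis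
      then show ?thesis by (simp only: algebra_simps)
    qed
    also have "int (Suc n) * int ?B = int (Suc n - m) * int ?C"
      by (metis C of_nat_mult)
    finally have "int (Suc n - m) * int d = int (Suc n - m) * (int (m * ?C) * (int k1 - int k2))"
      by (simp add: algebra_simps)
    then have "int d = int (m * ?C) * (int k1 - int k2)"
      using step by (subst (asm) mult_left_cancel) auto
    then have "int (m * ?C) dvd int d" by (metis dvd_triv_left)
    then show ?case by presburger
  qed
qed

text \<open>The number \<open>d\<close> in the proof is the least common multiple of \<open>1, \<dots>, n\<close>.\<close>

lemma power_le_power_card_primes:
  fixes n :: nat
  assumes "n \<ge> 2"
  shows "2 ^ n \<le> 4 * n ^ card {p. prime p \<and> p \<le> n}"
proof -
  let ?P = "{p. prime p \<and> p \<le> n}"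
  have fin: "finite ?P" by simp
  define e where "e p = Max {k. p ^ k \<le> n}" for p :: nat
  have fe: "finite {k. p ^ k \<le> n}" if "p \<in> ?P" for p
  proof (rule finite_subset)
    show "{k. p ^ k \<le> n} \<subseteq> {..n}"
    proof
      fix k assume "k \<in> {k. p ^ k \<le> n}"
      moreover have "k < p ^ k" using that prime_gt_1_nat by (simp add: power_gt_expt)
      ultimately show "k \<in> {..n}" by simp
    qed
  qed simp
  have e: "p ^ e p \<le> n" if "p \<in> ?P" for p
  proof -
    have "{k. p ^ k \<le> n} \<noteq> {}" using assms by (auto intro!: exI[of _ 0])
    from Max_in[OF fe[OF that] this] show ?thesis by (simp add: e_def)
  qed
  define d where "d = (\<Prod>p\<in>?P. p ^ e p)"
  have d0: "d \<noteq> 0" unfolding d_def using fin by (auto simp: prime_gt_0_nat)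
  have div: "j dvd d" if j: "1 \<le> j" "j \<le> n" for j
  proof (rule multiplicity_le_imp_dvd)
    show "j \<noteq> 0" using j by simp
    fix p :: nat assume p: "prime p"
    show "multiplicity p j \<le> multiplicity p d"
    proof (cases "p \<le> n")
      case True
      with p have pP: "p \<in> ?P" by simp
      have "p ^ multiplicity p j \<le> j" using j by (intro dvd_imp_le multiplicity_dvd) auto
      then have "multiplicity p j \<le> e p"
        unfolding e_def using j by (intro Max_ge fe[OF pP]) simp
      also have "e p = multiplicity p d"
        unfolding d_def by (subst multiplicity_prod_prime_powers) (use fin p True in auto)
      finally show ?thesis .
    next
      case False
      then have "\<not> p dvd j" using j by (auto dest: dvd_imp_le)
      then show ?thesis by (simp add: not_dvd_imp_multiplicity_0)
    qed
  qed
  define k where "k = n div 2"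
  have k: "k \<ge> 1" "2 * k \<le> n" "n \<le> 2 * k + 1" using assms by (auto simp: k_def)
  have "k * (2 * k choose k) dvd d"
    using k by (intro times_binomial_dvd div) auto
  then have "k * (2 * k choose k) \<le> d" using d0 by (intro dvd_imp_le) auto
  \<comment> \<open>By the choice of \<open>e\<close>, every prime power in \<open>d\<close> is at
    most \<open>n\<close>.\<close>
  also have "d \<le> (\<Prod>p\<in>?P. n)"
    unfolding d_def by (intro prod_mono) (use e in auto)
  finally have le: "k * (2 * k choose k) \<le> n ^ card ?P" by simp
  \<comment> \<open>The factor \<open>k\<close> supplied by \<open>times_binomial_dvd\<close>
    cancels the loss \<open>1 / (2 * k)\<close> in the central binomial bound.\<close>
  have "4 ^ k / (2 * real k) \<le> real (2 * k choose k)"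
    using central_binomial_lower_bound[of k] k by simp
  then have "4 ^ k \<le> 2 * real (k * (2 * k choose k))"
    using k by (simp add: field_simps)
  then have c: "4 ^ k \<le> 2 * (k * (2 * k choose k))"
    by (metis of_nat_le_iff of_nat_mult of_nat_numeral of_nat_power)
  \<comment> \<open>Rounding in \<open>n div 2\<close> costs a factor 2 for odd \<open>n\<close>;
    with the 2 of the central binomial bound this makes the 4.\<close>
  have "2 ^ n \<le> (2::nat) ^ (2 * k + 1)" using k by (intro power_increasing) auto
  also have "\<dots> = 2 * 4 ^ k" by (simp add: power_mult)
  finally show ?thesis using c le by linarith
qed

text \<open>All primes but 2 are odd, and the odd number 1, which is not prime, makes room for
  2.\<close>

lemma card_primes_le:
  fixes n :: nat
  assumes "n \<ge> 1"
  shows "2 * card {p. prime p \<and> p \<le> n} \<le> n + 1"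
proof -
  have "card {p. prime p \<and> p \<le> n} \<le> card (insert 2 ((\<lambda>k. 2 * k + 1) ` {1..<(n + 1) div 2}))"
  proof (rule card_mono)
    show "{p. prime p \<and> p \<le> n} \<subseteq> insert 2 ((\<lambda>k. 2 * k + 1) ` {1..<(n + 1) div 2})"
    proof
      fix p assume "p \<in> {p. prime p \<and> p \<le> n}"
      then have p: "prime p" "p \<le> n" by auto
      show "p \<in> insert 2 ((\<lambda>k. 2 * k + 1) ` {1..<(n + 1) div 2})"
      proof (cases "p = 2")
        case False
        with p have "odd p" "p > 2" using prime_odd_nat prime_ge_2_nat[of p] by auto
        then obtain k where "p = 2 * k + 1" by (elim oddE)
        with \<open>p > 2\<close> p show ?thesis by (auto intro!: image_eqI[of _ _ k])
      qed simp
    qed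
  qed simp
  also have "\<dots> \<le> Suc (card ((\<lambda>k. 2 * k + 1) ` {1..<(n + 1) div 2}))"
    by (rule card_insert_le_m1) auto
  also have "\<dots> \<le> Suc ((n + 1) div 2 - 1)"
    using card_image_le[of "{1..<(n + 1) div 2}" "\<lambda>k. 2 * k + 1"] by simp
  finally show ?thesis using assms by linarith
qed

subsection \<open>The Euler product and its tails\<close>

definition prime_prod :: "nat set \<Rightarrow> real" where
  "prime_prod S = (\<Prod>p\<in>S. 1 - 1 / (real p)^2)"

text \<open>The product of \<open>1 - 1/p\<^sup>2\<close> over all primes \<open>p \<ge> n\<close>, written so that no infinite product occurs.\<close>

definition tail_prod :: "nat \<Rightarrow> real" where
  "tail_prod n = 6 / pi^2 / prime_prod {p. prime p \<and> p < n}"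

lemma factor_pos:
  fixes p :: nat
  assumes "prime p"
  shows "0 < 1 - 1 / (real p)^2"
  using prime_gt_1_nat[OF assms] by (simp add: field_simps)

lemma prime_prod_pos: "(\<And>p. p \<in> S \<Longrightarrow> prime p) \<Longrightarrow> 0 < prime_prod S"
  unfolding prime_prod_def by (intro prod_pos factor_pos) auto

lemma prime_prod_antimono:
  assumes "finite S" "\<And>p. p \<in> S \<Longrightarrow> prime p" "U \<subseteq> S"
  shows "prime_prod S \<le> prime_prod U"
proof -
  have "prime_prod S = prime_prod U * prime_prod (S - U)"
    unfolding prime_prod_def using assms by (metis mult.commute prod.subset_diff)
  also have "\<dots> \<le> prime_prod U * 1"
  proof (intro mult_left_mono)
    show "prime_prod (S - U) \<le> 1"
      unfolding prime_prod_def
    proof (intro prod_le_1 conjI)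
      fix p assume "p \<in> S - U"
      then show "0 \<le> 1 - 1 / (real p)^2" using assms(2) factor_pos[of p] by simp
    qed simp
    show "0 \<le> prime_prod U"
      using assms by (intro less_imp_le prime_prod_pos) auto
  qed
  finally show ?thesis by simp
qed

text \<open>Euler's product as a sieve: removing the multiples of one more prime \<open>p\<close>
  from the index set multiplies the sum by \<open>1 - 1/p^2\<close>, starting from
  \<open>pi^2 / 6\<close>.\<close>

lemma has_sum_coprime_to_primes:
  fixes S :: "nat set"
  assumes "finite S" "\<And>p. p \<in> S \<Longrightarrow> prime p"
  shows "((\<lambda>k. 1 / (real k)^2) has_sum (pi^2 / 6 * prime_prod S)) {k. k \<ge> 1 \<and> (\<forall>p\<in>S. \<not> p dvd k)}"
  using assms
proof (induction S)
  case empty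
  have "((\<lambda>n. 1 / (real n + 1)\<^sup>2) has_sum (pi^2 / 6)) UNIV"
    by (rule norm_summable_imp_has_sum)
       (use inverse_squares_sums in \<open>auto simp: sums_iff add_ac\<close>)
  then have "((\<lambda>k. 1 / (real k)^2) has_sum (pi^2 / 6)) (range Suc)"
    by (subst has_sum_reindex) (auto simp: o_def add_ac)
  moreover have "range Suc = {k. k \<ge> 1}"
    by (auto simp: image_iff) (metis Suc_le_D One_nat_def)
  ultimately show ?case by (simp add: prime_prod_def)
next
  case (insert p S)
  let ?A = "{k. k \<ge> 1 \<and> (\<forall>q\<in>S. \<not> q dvd k)}"
  let ?f = "\<lambda>k::nat. 1 / (real k)^2"
  have p: "prime p" using insert.prems by auto
  then have p0: "p > 0" by (rule prime_gt_0_nat)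
  have IH: "(?f has_sum (pi^2 / 6 * prime_prod S)) ?A"
    using insert by auto
  have "((\<lambda>k. 1 / (real p)^2 * ?f k) has_sum (1 / (real p)^2 * (pi^2 / 6 * prime_prod S))) ?A"
    by (rule has_sum_cmult_right[OF IH])
  then have img: "(?f has_sum (1 / (real p)^2 * (pi^2 / 6 * prime_prod S))) ((\<lambda>k. p * k) ` ?A)"
    using p0 by (subst has_sum_reindex) (auto simp: o_def inj_on_def power_mult_distrib)
  have ne: "q \<noteq> p" "prime q" if "q \<in> S" for q using insert that by auto
  \<comment> \<open>As \<open>p\<close> is not in \<open>S\<close>, multiplying by \<open>p\<close>
    introduces no prime of \<open>S\<close>; hence the multiples of \<open>p\<close> in
    \<open>?A\<close> are exactly \<open>p * ?A\<close>.\<close>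
  have sub: "(\<lambda>k. p * k) ` ?A \<subseteq> ?A"
  proof clarify
    fix k assume k: "1 \<le> k" "\<forall>q\<in>S. \<not> q dvd k"
    have "\<not> q dvd p * k" if "q \<in> S" for q
      using ne[OF that] p k that by (metis prime_dvd_mult_iff primes_dvd_imp_eq)
    then show "1 \<le> p * k \<and> (\<forall>q\<in>S. \<not> q dvd p * k)" using k p0 by auto
  qed
  have "{k. k \<ge> 1 \<and> (\<forall>q\<in>insert p S. \<not> q dvd k)} = ?A - (\<lambda>k. p * k) ` ?A"
  proof -
    have "p dvd k \<longleftrightarrow> k \<in> (\<lambda>k. p * k) ` ?A" if "k \<in> ?A" for k
      using that by (auto simp: dvd_def Suc_le_eq intro!: image_eqI)
    then show ?thesis by blast
  qed
  moreover have "pi^2 / 6 * prime_prod (insert p S) =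
      pi^2 / 6 * prime_prod S - 1 / (real p)^2 * (pi^2 / 6 * prime_prod S)"
    using insert.hyps by (simp add: prime_prod_def algebra_simps)
  ultimately show ?case
    using has_sum_Diff[OF IH img sub] by (simp only:)
qed

text \<open>\<open>P\<close> is the sum of \<open>1/k^2\<close> over all \<open>k\<close> without a
  prime factor below \<open>n\<close>. Such a \<open>k\<close> is 1 or at least \<open>n\<close>, so
  \<open>P\<close> exceeds 1 by at most a tail of the series for \<open>pi^2 / 6\<close>.\<close>

lemma prime_prod_below_bounds:
  fixes n :: nat
  defines "P \<equiv> pi^2 / 6 * prime_prod {p. prime p \<and> p < n}"
  assumes n: "n \<ge> 2"
  shows "1 \<le> P" and "P \<le> 1 + (pi^2 / 6 - (\<Sum>k<n - 1. 1 / (real k + 1)^2))"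
proof -
  let ?f = "\<lambda>k::nat. 1 / (real k)^2"
  let ?A = "{k. k \<ge> 1 \<and> (\<forall>p\<in>{p. prime p \<and> p < n}. \<not> p dvd k)}"
  have sumP: "(?f has_sum P) ?A"
    unfolding P_def by (rule has_sum_coprime_to_primes) auto
  have one: "(?f has_sum 1) {1}"
    using has_sum_finite[of "{1::nat}" ?f] by simp
  have "1 \<in> ?A" by (auto dest: prime_gt_1_nat)
  then show "1 \<le> P"
    by (intro has_sum_mono2[OF one sumP]) auto
  have all: "(?f has_sum (pi^2 / 6)) {k. k \<ge> 1}"
    using has_sum_coprime_to_primes[of "{}"] by (simp add: prime_prod_def)
  have fin: "(?f has_sum (\<Sum>k\<in>{1..<n}. ?f k)) {1..<n}"
    by (rule has_sum_finite) simp
  have "(?f has_sum (pi^2 / 6 - (\<Sum>k\<in>{1..<n}. ?f k))) ({k. k \<ge> 1} - {1..<n})"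
    by (rule has_sum_Diff[OF all fin]) auto
  then have "(?f has_sum (1 + (pi^2 / 6 - (\<Sum>k\<in>{1..<n}. ?f k)))) ({1} \<union> ({k. k \<ge> 1} - {1..<n}))"
    using n by (intro has_sum_Un_disjoint one) auto
  moreover have "?A \<subseteq> {1} \<union> ({k. k \<ge> 1} - {1..<n})"
  proof
    fix k assume k: "k \<in> ?A"
    show "k \<in> {1} \<union> ({k. k \<ge> 1} - {1..<n})"
    proof (cases "k = 1")
      case False
      then obtain p where p: "prime p" "p dvd k" using prime_factor_nat by blast
      then have "p \<le> k" using k by (auto intro: dvd_imp_le)
      with p k show ?thesis by force
    qed simp
  qed
  ultimately have "P \<le> 1 + (pi^2 / 6 - (\<Sum>k\<in>{1..<n}. ?f k))"
    by (intro has_sum_mono2[OF sumP]) auto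
  also have "(\<Sum>k\<in>{1..<n}. ?f k) = (\<Sum>k<n - 1. 1 / (real k + 1)^2)"
    using n by (intro sum.reindex_bij_witness[of _ Suc "\<lambda>k. k - 1"]) auto
  finally show "P \<le> 1 + (pi^2 / 6 - (\<Sum>k<n - 1. 1 / (real k + 1)^2))" .
qed

lemma tail_prod_eq: "tail_prod n = 1 / (pi^2 / 6 * prime_prod {p. prime p \<and> p < n})"
  by (simp add: tail_prod_def)

lemma tail_prod_pos: "0 < tail_prod n"
  unfolding tail_prod_eq by (intro divide_pos_pos mult_pos_pos prime_prod_pos) auto

lemma tail_prod_le_1: "n \<ge> 2 \<Longrightarrow> tail_prod n \<le> 1"
  using prime_prod_below_bounds(1)[of n] unfolding tail_prod_eq by simp

text \<open>Equivalent to the Euler product for \<open>6 / pi^2\<close>; both bounds of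
  \<open>prime_prod_below_bounds\<close> tend to 1.\<close>

lemma tail_prod_tendsto: "tail_prod \<longlonglongrightarrow> 1"
proof -
  have s: "(\<lambda>n. \<Sum>k<n. 1 / (real k + 1)^2) \<longlonglongrightarrow> pi^2 / 6"
    using inverse_squares_sums unfolding sums_def by (simp add: add_ac)
  have "filterlim (\<lambda>n::nat. n - 1) sequentially sequentially"
    by (rule filterlim_minus_const_nat_at_top)
  from filterlim_compose[OF s this]
  have "(\<lambda>n. 1 + (pi^2 / 6 - (\<Sum>k<n - 1. 1 / (real k + 1)^2))) \<longlonglongrightarrow> 1 + (pi^2 / 6 - pi^2 / 6)"
    by (intro tendsto_intros)
  then have u: "(\<lambda>n. 1 + (pi^2 / 6 - (\<Sum>k<n - 1. 1 / (real k + 1)^2))) \<longlonglongrightarrow> 1" by simp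
  have "(\<lambda>n. pi^2 / 6 * prime_prod {p. prime p \<and> p < n}) \<longlonglongrightarrow> 1"
  proof (rule tendsto_sandwich[OF _ _ tendsto_const u])
    show "\<forall>\<^sub>F n in sequentially. 1 \<le> pi^2 / 6 * prime_prod {p. prime p \<and> p < n}"
      using eventually_ge_at_top[of 2] by eventually_elim (rule prime_prod_below_bounds(1))
    show "\<forall>\<^sub>F n in sequentially. pi^2 / 6 * prime_prod {p. prime p \<and> p < n} \<le>
        1 + (pi^2 / 6 - (\<Sum>k<n - 1. 1 / (real k + 1)^2))"
      using eventually_ge_at_top[of 2] by eventually_elim (rule prime_prod_below_bounds(2))
  qed
  then have "(\<lambda>n. 1 / (pi^2 / 6 * prime_prod {p. prime p \<and> p < n})) \<longlonglongrightarrow> 1 / 1"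
    by (intro tendsto_divide tendsto_const) auto
  then show ?thesis by (simp add: tail_prod_eq[abs_def])
qed

lemma primes_below_Suc:
  "{p::nat. prime p \<and> p < Suc n} = (if prime n then insert n {p. prime p \<and> p < n} else {p. prime p \<and> p < n})"
  by (auto simp: less_Suc_eq)

lemma tail_prod_Suc:
  "tail_prod n = (if prime n then (1 - 1 / (real n)^2) * tail_prod (Suc n) else tail_prod (Suc n))"
proof (cases "prime n")
  case True
  have "prime_prod {p. prime p \<and> p < Suc n} = (1 - 1 / (real n)^2) * prime_prod {p. prime p \<and> p < n}"
    unfolding primes_below_Suc prime_prod_def using True by simp
  moreover have "1 - 1 / (real n)^2 \<noteq> 0" using factor_pos[OF True] by linarith
  moreover have "a / q = c * (a / (c * q))" if "c \<noteq> 0" for a c q :: real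
    using that by simp
  ultimately show ?thesis
    using True unfolding tail_prod_def by metis
next
  case False
  then show ?thesis unfolding tail_prod_def primes_below_Suc by simp
qed

text \<open>Enlarging \<open>S\<close> to all primes in \<open>[n, M)\<close> lowers the product,
  and multiplying by the remaining tail \<open>tail_prod M \<le> 1\<close> lowers it further, to
  \<open>tail_prod n\<close>.\<close>

lemma tail_prod_le_prime_prod:
  assumes "n \<ge> 2" "finite S" "\<And>p. p \<in> S \<Longrightarrow> prime p \<and> n \<le> p"
  shows "tail_prod n \<le> prime_prod S"
proof -
  obtain M where M: "M \<ge> n" "S \<subseteq> {..<M}"
    using finite_nat_iff_bounded[of S] assms(2)
    by (metis dual_order.trans lessThan_subset_iff nle_le)
  let ?B = "{p. prime p \<and> p < n}" and ?C = "{p. prime p \<and> n \<le> p \<and> p < M}"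
  have "prime_prod {p. prime p \<and> p < M} = prime_prod (?B \<union> ?C)"
    using M by (intro arg_cong[of _ _ prime_prod]) auto
  also have "\<dots> = prime_prod ?B * prime_prod ?C"
    unfolding prime_prod_def by (rule prod.union_disjoint) auto
  finally have "prime_prod ?C * tail_prod M = tail_prod n"
    using prime_prod_pos[of ?C] by (simp add: tail_prod_def)
  moreover have "prime_prod ?C * tail_prod M \<le> prime_prod ?C * 1"
    using M assms(1) prime_prod_pos[of ?C] by (intro mult_left_mono tail_prod_le_1) auto
  moreover have "prime_prod ?C \<le> prime_prod S"
    using M assms by (intro prime_prod_antimono) auto
  ultimately show ?thesis by simp
qed

subsection \<open>Tails after a prime\<close>

text \<open>Each prime in \<open>S\<close> contributes a factor at most \<open>1 - 1/m^2\<close>. By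
  Bernoulli the product is at most \<open>1 / (1 + card S / m^2)\<close>, and the bound on
  \<open>card S\<close> makes this at most \<open>1 - 1/p^2\<close>.\<close>

lemma gap_of_many_primes:
  fixes p m :: nat
  assumes p: "p \<ge> 2" and "S \<noteq> {}" and S: "\<And>q. q \<in> S \<Longrightarrow> prime q \<and> p < q \<and> q \<le> m"
    and card: "m^2 \<le> card S * (p^2 - 1)"
  shows "tail_prod (Suc p) \<le> 1 - 1 / (real p)^2"
proof -
  have fin: "finite S" by (rule finite_subset[of _ "{..m}"]) (use S in auto)
  from \<open>S \<noteq> {}\<close> obtain q where "q \<in> S" by blast
  then have m: "m > 2" using S[of q] p by auto
  define x where "x = 1 / (real m)^2"
  have x: "0 \<le> x" "x \<le> 1" using m by (auto simp: x_def field_simps)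
  have "tail_prod (Suc p) \<le> prime_prod S"
    using p S fin by (intro tail_prod_le_prime_prod) (auto simp: Suc_le_eq)
  also have "\<dots> \<le> (\<Prod>q\<in>S. 1 - x)"
    unfolding prime_prod_def
  proof (intro prod_mono conjI)
    fix q assume "q \<in> S"
    then have q: "prime q" "q \<le> m" using S by auto
    show "0 \<le> 1 - 1 / (real q)^2" using factor_pos[OF q(1)] by simp
    show "1 - 1 / (real q)^2 \<le> 1 - x"
      using q prime_gt_0_nat[of q] by (auto simp: x_def intro!: divide_left_mono power_mono)
  qed
  finally have le: "tail_prod (Suc p) \<le> (1 - x) ^ card S" by simp
  \<comment> \<open>Bernoulli is applied to \<open>1 + x\<close>, since an upper bound for the power
    of \<open>1 - x\<close> is wanted.\<close>
  have "(1 + of_nat (card S) * x) * (1 - x) ^ card S \<le> (1 + x) ^ card S * (1 - x) ^ card S"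
    using x by (intro mult_right_mono Bernoulli_inequality) auto
  also have "\<dots> = (1 - x^2) ^ card S"
    by (simp add: power_mult_distrib[symmetric] algebra_simps power2_eq_square)
  also have "\<dots> \<le> 1"
    using x by (intro power_le_one) (auto simp: power_le_one)
  finally have b: "(1 + real (card S) * x) * (1 - x) ^ card S \<le> 1" .
  have p2: "real p ^ 2 > 1" using p by (simp add: one_less_power)
  have "real (m^2) \<le> real (card S * (p^2 - 1))" using card of_nat_le_iff by blast
  then have "(real m)^2 \<le> real (card S) * ((real p)^2 - 1)"
    using p by (simp add: of_nat_diff)
  then have "1 / ((real p)^2 - 1) \<le> real (card S) * x"
    using p2 m by (simp add: x_def field_simps)
  then have "(1 + 1 / ((real p)^2 - 1)) * (1 - x) ^ card S \<le> 1"
    using b x by (smt (verit) mult_right_mono zero_le_power)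
  moreover have "1 + 1 / ((real p)^2 - 1) = 1 / (1 - 1 / (real p)^2)"
  proof -
    have "1 + 1 / (a - 1) = 1 / (1 - 1 / a)" if "a > 1" for a :: real
      using that by (simp add: field_simps)
    then show ?thesis using p2 by blast
  qed
  moreover have "0 < 1 - 1 / (real p)^2"
    using p2 by (subst diff_gt_0_iff_gt, subst divide_less_eq_1_pos) (use p in auto)
  moreover have "y \<le> c" if "1 / c * y \<le> 1" "0 < c" for c y :: real
    using that by (simp add: field_simps)
  ultimately have "(1 - x) ^ card S \<le> 1 - 1 / (real p)^2" by metis
  with le show ?thesis by simp
qed

section \<open>Large primes via the Chebyshev bound\<close>

text \<open>The threshold \<open>841 = 29^2\<close> of \<open>gap_large\<close> comes from here: the
  inequality fails at \<open>s = 28\<close>.\<close>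

lemma power5_le_two_power:
  fixes s :: nat
  assumes "29 \<le> s"
  shows "(s + 1) ^ 5 \<le> 2 ^ (s - 4)"
  using assms
proof (induction s rule: dec_induct)
  case base
  then show ?case by simp
next
  case (step s)
  define t where "t = s + 1"
  have t: "30 \<le> t" using step by (simp add: t_def)
  have "(t + 1)^5 = t^5 + 5 * t^4 + 10 * t^3 + 10 * t^2 + 5 * t + 1"
    by (simp add: eval_nat_numeral algebra_simps)
  also have "\<dots> \<le> 2 * t^5"
  proof -
    have "t ^ k * 30 \<le> t ^ (k + 1)" for k using t by simp
    from this[of 1] this[of 2] this[of 3] this[of 4]
    have "t * 30 \<le> t^2" "t^2 * 30 \<le> t^3" "t^3 * 30 \<le> t^4" "t^4 * 30 \<le> t^5"
      by (simp_all add: power2_eq_square)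
    then show ?thesis using t by linarith
  qed
  also have "\<dots> \<le> 2 * 2 ^ (s - 4)" using step by (simp add: t_def)
  also have "\<dots> = 2 ^ (Suc s - 4)" using step by (subst Suc_diff_le) auto
  finally show ?case by (simp add: t_def)
qed

text \<open>Since \<open>n^2 \<le> p^3 \<le> (p + 1) * (p^2 - 1)\<close>, it suffices to find
  \<open>p + 1\<close> primes in \<open>(p, n]\<close>. With fewer, \<open>card_primes_le\<close>
  gives \<open>2 * \<pi> n \<le> 3 * p + 1\<close>, which contradicts the Chebyshev bound.\<close>

lemma gap_large:
  fixes p :: nat
  assumes "p \<ge> 841"
  shows "tail_prod (Suc p) \<le> 1 - 1 / (real p)^2"
proof -
  define s where "s = floor_sqrt p"
  have s1: "s^2 \<le> p" and s2: "p < (s + 1)^2"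
    by (simp_all add: s_def Suc_floor_sqrt_power2_gt)
  have "29 < s + 1"
    by (rule power_less_imp_less_base[of _ 2]) (use s2 assms in auto)
  then have s: "s \<ge> 29" by simp
  define n where "n = s * p"
  have pn: "p \<le> n" using s by (simp add: n_def)
  define \<pi> where "\<pi> m = card {q. prime q \<and> q \<le> m}" for m :: nat
  define S where "S = {q. prime q \<and> p < q \<and> q \<le> n}"
  have card: "\<pi> n = \<pi> p + card S"
  proof -
    have "{q. prime q \<and> q \<le> n} = {q. prime q \<and> q \<le> p} \<union> S"
      using pn by (auto simp: S_def)
    moreover have "card ({q. prime q \<and> q \<le> p} \<union> S) = \<pi> p + card S"
      unfolding \<pi>_def by (rule card_Un_disjoint) (auto simp: S_def)
    ultimately show ?thesis by (simp add: \<pi>_def)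
  qed
  have "card S \<ge> p + 1"
  proof (rule ccontr)
    assume "\<not> card S \<ge> p + 1"
    then have pi: "2 * \<pi> n \<le> 3 * p + 1"
      using card card_primes_le[of p] assms by (simp add: \<pi>_def)
    have n: "n \<le> (s + 1)^3"
    proof -
      have "n \<le> (s + 1) * (s + 1)^2"
        unfolding n_def using s2 by (intro mult_mono) auto
      then show ?thesis by (simp add: power3_eq_cube power2_eq_square algebra_simps)
    qed
    have n0: "n \<ge> 2" using assms pn by linarith
    have "2 ^ n \<le> 4 * n ^ \<pi> n"
      unfolding \<pi>_def using n0 by (rule power_le_power_card_primes)
    \<comment> \<open>The exponent is \<open>2 * 5\<close>: the 2 matches the bound on
      \<open>2 * \<pi> n\<close>, the 5 yields the fifth powers for
      \<open>power5_le_two_power\<close>.\<close>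
    then have "(2 ^ n) ^ 10 \<le> (4 * n ^ \<pi> n) ^ 10" by (intro power_mono) auto
    also have "\<dots> = 4 ^ 10 * (n ^ (2 * \<pi> n)) ^ 5"
      by (simp add: power_mult_distrib mult.commute flip: power_mult)
    also have "\<dots> \<le> 4 ^ 10 * (n ^ (3 * p + 1)) ^ 5"
      using pi n0 by (intro mult_left_mono power_mono power_increasing) auto
    also have "\<dots> \<le> 4 ^ 10 * (((s + 1)^3) ^ (3 * p + 1)) ^ 5"
      using n by (intro mult_left_mono power_mono) auto
    also have "\<dots> = 4 ^ 10 * ((s + 1) ^ 5) ^ (9 * p + 3)"
    proof -
      have "3 * (3 * p + 1) * 5 = 5 * (9 * p + 3)" by simp
      then show ?thesis by (simp only: power_mult[symmetric])
    qed
    also have "\<dots> \<le> 4 ^ 10 * (2 ^ (s - 4)) ^ (9 * p + 3)"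
      using power5_le_two_power[OF s] by (intro mult_left_mono power_mono) auto
    also have "\<dots> = (2 ^ 2) ^ 10 * (2 ^ (s - 4)) ^ (9 * p + 3)" by simp
    also have "\<dots> = (2::nat) ^ (20 + (s - 4) * (9 * p + 3))"
      unfolding power_mult[symmetric] power_add[symmetric] by simp
    finally have "(2::nat) ^ (n * 10) \<le> 2 ^ (20 + (s - 4) * (9 * p + 3))"
      by (simp only: power_mult)
    then have "n * 10 \<le> 20 + (s - 4) * (9 * p + 3)"
      by (rule power_le_imp_le_exp[rotated]) simp
    \<comment> \<open>Here \<open>10 * s * p\<close> stands against the leading term
      \<open>9 * s * p\<close>; writing \<open>s\<close> as \<open>4 + r\<close> removes the
      truncated subtraction.\<close>
    moreover obtain r where "s = 4 + r" using s le_Suc_ex[of 4 s] by auto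
    ultimately have "r * p + 40 * p \<le> 20 + 3 * r"
      by (simp add: n_def algebra_simps)
    moreover have "3 * r \<le> r * p" using assms by simp
    ultimately show False using assms by linarith
  qed
  then have "S \<noteq> {}" by auto
  from \<open>card S \<ge> p + 1\<close> have "(p + 1) * (p^2 - 1) \<le> card S * (p^2 - 1)" by (rule mult_right_mono) simp
  moreover have "n^2 \<le> p * p^2"
    using s1 by (simp add: n_def power_mult_distrib)
  moreover have "p * p^2 \<le> (p + 1) * (p^2 - 1)"
  proof -
    obtain k where k: "p = 2 + k" using assms le_Suc_ex[of 2 p] by auto
    show ?thesis unfolding k by (simp add: power2_eq_square algebra_simps)
  qed
  ultimately show ?thesis
    using assms by (intro gap_of_many_primes[of p S n] \<open>S \<noteq> {}\<close>) (auto simp: S_def)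
qed

section \<open>Small primes via explicit lists\<close>

lemma gap_of_explicit_primes:
  assumes "finite S" "\<And>q. q \<in> S \<Longrightarrow> prime q \<and> p < q" "p \<ge> 1"
    "prime_prod S \<le> 1 - 1 / (real p)^2"
  shows "tail_prod (Suc p) \<le> 1 - 1 / (real p)^2"
  by (rule order_trans[OF tail_prod_le_prime_prod assms(4)])
     (use assms(1-3) in \<open>auto simp: Suc_le_eq\<close>)

text \<open>One list of primes above \<open>b\<close> serves every \<open>p\<close> in
  \<open>[a, b]\<close>, because the counting condition is hardest at \<open>p = a\<close>.\<close>

lemma gap_range:
  fixes a p :: nat
  assumes "S \<noteq> {}" "a \<ge> 2" "\<forall>q\<in>S. prime q \<and> b < q \<and> q \<le> m" "m^2 \<le> card S * (a^2 - 1)"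
    and "a \<le> p" "p \<le> b"
  shows "tail_prod (Suc p) \<le> 1 - 1 / (real p)^2"
proof (rule gap_of_many_primes[of p S m])
  have "card S * (a^2 - 1) \<le> card S * (p^2 - 1)"
    using assms by (intro mult_left_mono diff_le_mono power_mono) auto
  then show "m^2 \<le> card S * (p^2 - 1)" using assms(4) by linarith
qed (use assms in force)+

text \<open>The counting criterion is too lossy here: for \<open>p = 11\<close>, the primes 13, 17,
  19 would need \<open>361 \<le> 3 * 120\<close>. The products themselves are evaluated
  instead.\<close>

lemma gap_below_17:
  fixes p :: nat
  assumes "prime p" "5 \<le> p" "p < 17"
  shows "tail_prod (Suc p) \<le> 1 - 1 / (real p)^2"
proof -
  have "p \<noteq> 6" "p \<noteq> 8" "p \<noteq> 9" "p \<noteq> 10" "p \<noteq> 12" "p \<noteq> 14" "p \<noteq> 15" "p \<noteq> 16"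
    using assms(1) by (auto intro!: notI)
  moreover have "p = 5 \<or> p = 6 \<or> p = 7 \<or> p = 8 \<or> p = 9 \<or> p = 10 \<or> p = 11 \<or> p = 12 \<or>
      p = 13 \<or> p = 14 \<or> p = 15 \<or> p = 16"
    using assms(2,3) by arith
  ultimately consider "p = 5" | "p = 7" | "p = 11" | "p = 13" by blast
  then show ?thesis
  proof cases
    case 1
    show ?thesis unfolding 1
      by (rule gap_of_explicit_primes[of "{7, 11, 13, 17, 19, 23}"]) (auto simp: prime_prod_def)
  next
    case 2
    show ?thesis unfolding 2
      by (rule gap_of_explicit_primes[of "{11, 13, 17, 19, 23}"]) (auto simp: prime_prod_def)
  next
    case 3
    show ?thesis unfolding 3
      by (rule gap_of_explicit_primes[of "{13, 17, 19}"]) (auto simp: prime_prod_def)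
  next
    case 4
    show ?thesis unfolding 4
      by (rule gap_of_explicit_primes[of "{17, 19}"]) (auto simp: prime_prod_def)
  qed
qed

text \<open>In a proper factorization both factors would be at least \<open>k\<close>. The divisors
  range over a list so that \<open>simp\<close> can enumerate them.\<close>

lemma prime_by_trial_division:
  fixes n k :: nat
  assumes "1 < n" "n < k^2" "\<forall>d\<in>set [2..<k]. \<not> d dvd n"
  shows "prime n"
proof (rule ccontr)
  assume "\<not> prime n"
  with assms(1) obtain a where "a dvd n" "a \<noteq> 1" "a \<noteq> n" "0 < n"
    unfolding prime_nat_iff by auto
  then obtain b where ab: "n = a * b" "1 < a" "1 < b"
    by (metis dvdE less_one linorder_neqE_nat mult.right_neutral mult_is_0 nat_neq_iff)
  have "k \<le> d" if "d dvd n" "1 < d" for d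
    using assms(3) that by (force intro: leI)
  with ab have "k \<le> a" "k \<le> b" by auto
  then have "k * k \<le> a * b" by (rule mult_mono) auto
  with assms(2) ab(1) show False by (simp add: power2_eq_square)
qed

text \<open>Trial division up to 29 suffices below \<open>900 = 30^2\<close>. These facts later
  replace the evaluation by \<open>prime_nat_numeral_eq\<close>.\<close>

lemma primes_between_100_and_900:
  "prime (113::nat)" "prime (127::nat)" "prime (131::nat)"
  "prime (181::nat)" "prime (191::nat)" "prime (193::nat)"
  "prime (307::nat)" "prime (311::nat)" "prime (313::nat)"
  "prime (509::nat)" "prime (521::nat)" "prime (523::nat)"
  "prime (863::nat)" "prime (877::nat)" "prime (881::nat)"
  by (rule prime_by_trial_division[of _ 30]; simp)+

text \<open>Each range ends just before the least prime of its list, and the next range starts at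
  that prime. The last one, ending before 863, overlaps with \<open>gap_large\<close>.\<close>

lemma gap_from_17_to_862:
  fixes p :: nat
  assumes "17 \<le> p" "p \<le> 862"
  shows "tail_prod (Suc p) \<le> 1 - 1 / (real p)^2"
proof -
  consider "17 \<le> p" "p \<le> 18" | "19 \<le> p" "p \<le> 22" | "23 \<le> p" "p \<le> 28"
    | "29 \<le> p" "p \<le> 36" | "37 \<le> p" "p \<le> 52" | "53 \<le> p" "p \<le> 78"
    | "79 \<le> p" "p \<le> 112" | "113 \<le> p" "p \<le> 180" | "181 \<le> p" "p \<le> 306"
    | "307 \<le> p" "p \<le> 508" | "509 \<le> p" "p \<le> 862"
    using assms by linarith
  then show ?thesis
  proof cases
    case 1
    show ?thesis by (rule gap_range[OF _ _ _ _ 1, of "{19, 23}" 23]) auto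
  next
    case 2
    show ?thesis by (rule gap_range[OF _ _ _ _ 2, of "{23, 29, 31}" 31]) auto
  next
    case 3
    show ?thesis by (rule gap_range[OF _ _ _ _ 3, of "{29, 31}" 31]) auto
  next
    case 4
    show ?thesis by (rule gap_range[OF _ _ _ _ 4, of "{37, 41, 43}" 43]) auto
  next
    case 5
    show ?thesis by (rule gap_range[OF _ _ _ _ 5, of "{53, 59, 61}" 61]) auto
  next
    case 6
    show ?thesis by (rule gap_range[OF _ _ _ _ 6, of "{79, 83, 89}" 89]) auto
  next
    case 7
    show ?thesis by (rule gap_range[OF _ _ _ _ 7, of "{113, 127, 131}" 131])
        (auto simp: primes_between_100_and_900 simp del: prime_nat_numeral_eq)
  next
    case 8
    show ?thesis by (rule gap_range[OF _ _ _ _ 8, of "{181, 191, 193}" 193])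
        (auto simp: primes_between_100_and_900 simp del: prime_nat_numeral_eq)
  next
    case 9
    show ?thesis by (rule gap_range[OF _ _ _ _ 9, of "{307, 311, 313}" 313])
        (auto simp: primes_between_100_and_900 simp del: prime_nat_numeral_eq)
  next
    case 10
    show ?thesis by (rule gap_range[OF _ _ _ _ 10, of "{509, 521, 523}" 523])
        (auto simp: primes_between_100_and_900 simp del: prime_nat_numeral_eq)
  next
    case 11
    show ?thesis by (rule gap_range[OF _ _ _ _ 11, of "{863, 877, 881}" 881])
        (auto simp: primes_between_100_and_900 simp del: prime_nat_numeral_eq)
  qed
qed

text \<open>At \<open>p = 3\<close> this fails, as \<open>9 / pi^2 > 8/9\<close>; hence the primes 2
  and 3 are kept apart.\<close>

lemma tail_prod_Suc_le:
  fixes p :: nat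
  assumes "prime p" "5 \<le> p"
  shows "tail_prod (Suc p) \<le> 1 - 1 / (real p)^2"
  using assms gap_below_17[of p] gap_from_17_to_862[of p] gap_large[of p] by linarith

subsection \<open>The closure\<close>

text \<open>Invariant of the greedy choice: \<open>x\<close> stays between the current product and
  the product obtained by also taking all primes from \<open>n\<close> on. A prime is taken whenever
  the product stays at least \<open>x\<close>.\<close>

lemma greedy_primes:
  fixes x :: real
  assumes "tail_prod 5 \<le> x" "x \<le> 1" "n \<ge> 5"
  shows "\<exists>S\<subseteq>{p. prime p \<and> 5 \<le> p \<and> p < n}. x \<le> prime_prod S \<and> prime_prod S * tail_prod n \<le> x"
  using assms(3)
proof (induction n rule: dec_induct)
  case base
  show ?case using assms(1,2) by (intro exI[of _ "{}"]) (simp add: prime_prod_def)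
next
  case (step n)
  then obtain S where S: "S \<subseteq> {p. prime p \<and> 5 \<le> p \<and> p < n}" "x \<le> prime_prod S"
    "prime_prod S * tail_prod n \<le> x" by blast
  then have S': "S \<subseteq> {p. prime p \<and> 5 \<le> p \<and> p < Suc n}" by auto
  show ?case
  proof (cases "prime n")
    case False
    then show ?thesis using S S' tail_prod_Suc[of n] by (intro exI[of _ S]) auto
  next
    case True
    have "finite S" by (rule finite_subset[OF S(1)]) auto
    then have ins: "prime_prod (insert n S) = prime_prod S * (1 - 1 / (real n)^2)"
      unfolding prime_prod_def using S by (subst prod.insert) auto
    show ?thesis
    proof (cases "x \<le> prime_prod S * (1 - 1 / (real n)^2)")
      case True
      have "prime_prod S * (1 - 1 / (real n)^2) * tail_prod (Suc n) \<le> x"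
        using S(3) tail_prod_Suc[of n] \<open>prime n\<close> by (simp add: mult.assoc)
      with True show ?thesis
        using S' step.hyps \<open>prime n\<close> by (intro exI[of _ "insert n S"]) (auto simp: ins)
    next
      case False
      \<comment> \<open>If taking \<open>n\<close> would undershoot \<open>x\<close>, then so does
        taking all later primes instead; thus skipping \<open>n\<close> keeps the invariant.\<close>
      have "prime_prod S * tail_prod (Suc n) \<le> prime_prod S * (1 - 1 / (real n)^2)"
      proof (rule mult_left_mono)
        show "tail_prod (Suc n) \<le> 1 - 1 / (real n)^2"
          using \<open>prime n\<close> step.hyps by (intro tail_prod_Suc_le) auto
        show "0 \<le> prime_prod S" using S(1) by (intro less_imp_le prime_prod_pos) auto
      qed
      with False S S' show ?thesis by (intro exI[of _ S]) auto
    qed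
  qed
qed

text \<open>The squarefree witness \<open>\<Prod>S\<close> has exactly the elements of
  \<open>S\<close> as prime divisors.\<close>

lemma prime_prod_in_D2:
  assumes "finite S" "\<And>p. p \<in> S \<Longrightarrow> prime p"
  shows "prime_prod S \<in> D2"
proof -
  define b where "b = \<Prod>S"
  have b: "b \<noteq> 0" unfolding b_def using assms prime_gt_0_nat by auto
  have "{p. prime p \<and> p dvd b} = S"
  proof (intro equalityI subsetI)
    fix p assume "p \<in> {p. prime p \<and> p dvd b}"
    then obtain q where "q \<in> S" "p dvd q" "prime p"
      unfolding b_def using prime_dvd_prod_iff[OF assms(1), of p "\<lambda>q. q"] by auto
    then show "p \<in> S" using assms(2) primes_dvd_imp_eq by metis
  next
    fix p assume "p \<in> S"
    then have "p dvd b" unfolding b_def using assms(1) by (intro dvd_prodI[of S p "\<lambda>p. p"])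
    with \<open>p \<in> S\<close> assms(2) show "p \<in> {p. prime p \<and> p dvd b}" by simp
  qed
  then have "prime_divisor_prod (int b) = prime_prod S"
    using b by (subst prime_divisor_prod_nonzero) (auto simp: prime_prod_def)
  then have "prime_prod S = prime_divisor_prod (int b) \<and> True" by simp
  then show ?thesis unfolding D2_def by (intro CollectI exI)
qed

lemma D2_cases:
  assumes "x \<in> D2"
  obtains (fin) S where "finite S" "\<And>p. p \<in> S \<Longrightarrow> prime p" "x = prime_prod S"
    | (zero) "x = 6 / pi^2"
proof -
  from assms obtain b where b: "x = prime_divisor_prod b" unfolding D2_def by blast
  show ?thesis
  proof (cases "b = 0")
    case False
    let ?S = "{p. prime p \<and> int p dvd b}"
    have "?S \<subseteq> {..nat \<bar>b\<bar>}"
    proof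
      fix p assume "p \<in> ?S"
      then have "\<bar>int p\<bar> \<le> \<bar>b\<bar>" using False by (intro dvd_imp_le_int) simp_all
      then show "p \<in> {..nat \<bar>b\<bar>}" by simp
    qed
    then have "finite ?S" using finite_subset by blast
    moreover have "x = prime_prod ?S"
      unfolding b prime_prod_def by (rule prime_divisor_prod_nonzero[OF False])
    ultimately show ?thesis by (intro fin[of ?S]) auto
  next
    case True
    let ?f = "\<lambda>p::nat. if prime p then 1 - 1 / (real p)^2 else 1"
    have "(\<lambda>n. \<Prod>i\<le>n. ?f i) \<longlonglongrightarrow> x"
      using convergent_prod_LIMSEQ[OF convergent_prime_divisor_prod[of 0]]
      unfolding b True prime_divisor_prod_def by simp
    \<comment> \<open>The product over all primes is evaluated through its partial products, which
      differ from \<open>6 / pi^2\<close> by a tail tending to 1.\<close>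
    moreover have "(\<Prod>i\<le>n. ?f i) = 6 / pi^2 / tail_prod (Suc n)" for n
    proof -
      have "(\<Prod>i\<le>n. ?f i) = (\<Prod>i\<in>{i\<in>{..n}. prime i}. 1 - 1 / (real i)^2)"
        by (rule prod.inter_filter[symmetric]) simp
      also have "{i\<in>{..n}. prime i} = {p. prime p \<and> p < Suc n}" by auto
      finally show ?thesis
        unfolding tail_prod_def prime_prod_def by simp
    qed
    moreover have "(\<lambda>n. 6 / pi^2 / tail_prod (Suc n)) \<longlonglongrightarrow> 6 / pi^2 / 1"
      by (intro tendsto_divide tendsto_const LIMSEQ_Suc tail_prod_tendsto) auto
    ultimately have "x = 6 / pi^2 / 1" by (simp only: LIMSEQ_unique)
    then show ?thesis by (intro zero) simp
  qed
qed

lemma tail_prod_5: "tail_prod 5 = 9 / pi^2"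
proof -
  have "{p::nat. prime p \<and> p < 5} = {2, 3}"
  proof (intro equalityI subsetI)
    fix p :: nat assume p: "p \<in> {p. prime p \<and> p < 5}"
    then have "p = 0 \<or> p = 1 \<or> p = 2 \<or> p = 3 \<or> p = 4" by auto
    then show "p \<in> {2, 3}" using p by auto
  qed auto
  then show ?thesis by (simp add: tail_prod_def prime_prod_def)
qed

text \<open>Stopping the greedy choice at \<open>n + 5\<close> gives a product between
  \<open>x\<close> and \<open>x / tail_prod (n + 5)\<close>, hence a sequence tending to
  \<open>x\<close>. Its primes are at least 5, so the factor for \<open>U\<close> can be
  adjoined.\<close>

lemma scaled_interval_subset_closure:
  assumes U: "U \<subseteq> {2, 3}" and x: "9 / pi^2 \<le> x" "x \<le> 1"
  shows "prime_prod U * x \<in> closure D2"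
proof -
  have prU: "finite U" "\<And>p. p \<in> U \<Longrightarrow> prime p"
    using U finite_subset[of U "{2, 3}"] by auto
  have "\<exists>S\<subseteq>{p. prime p \<and> 5 \<le> p}. finite S \<and> x \<le> prime_prod S \<and>
      prime_prod S \<le> x / tail_prod (n + 5)" for n
  proof -
    obtain S where "S \<subseteq> {p. prime p \<and> 5 \<le> p \<and> p < n + 5}" "x \<le> prime_prod S"
      "prime_prod S * tail_prod (n + 5) \<le> x"
      using greedy_primes[of x "n + 5"] x tail_prod_5 by auto
    moreover from this(1) have "finite S" by (rule finite_subset) auto
    ultimately show ?thesis
      using tail_prod_pos[of "n + 5"] by (intro exI[of _ S]) (auto simp: pos_le_divide_eq)
  qed
  then have "\<forall>n. \<exists>S. S \<subseteq> {p. prime p \<and> 5 \<le> p} \<and> finite S \<and> x \<le> prime_prod S \<and>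
      prime_prod S \<le> x / tail_prod (n + 5)" by blast
  from choice[OF this] obtain S where
    S: "\<And>n. S n \<subseteq> {p. prime p \<and> 5 \<le> p}" "\<And>n. finite (S n)"
      "\<And>n. x \<le> prime_prod (S n)" "\<And>n. prime_prod (S n) \<le> x / tail_prod (n + 5)" by blast
  have "(\<lambda>n. x / tail_prod (n + 5)) \<longlonglongrightarrow> x / 1"
    by (rule tendsto_divide[OF tendsto_const LIMSEQ_ignore_initial_segment[OF tail_prod_tendsto]]) simp
  then have upper: "(\<lambda>n. x / tail_prod (n + 5)) \<longlonglongrightarrow> x" by simp
  have "(\<lambda>n. prime_prod (S n)) \<longlonglongrightarrow> x"
    by (rule tendsto_sandwich[OF _ _ tendsto_const upper]; intro always_eventually allI S)
  then have lim: "(\<lambda>n. prime_prod U * prime_prod (S n)) \<longlonglongrightarrow> prime_prod U * x"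
    by (rule tendsto_mult_left)
  have "prime_prod U * prime_prod (S n) \<in> D2" for n
  proof -
    have "q \<le> 3" if "q \<in> U" for q using that U by auto
    moreover have "5 \<le> q" if "q \<in> S n" for q using that S(1)[of n] by auto
    ultimately have "U \<inter> S n = {}" by fastforce
    then have "prime_prod U * prime_prod (S n) = prime_prod (U \<union> S n)"
      unfolding prime_prod_def by (intro prod.union_disjoint[symmetric] prU(1) S(2))
    also have "\<dots> \<in> D2" by (rule prime_prod_in_D2) (use prU S(1,2)[of n] in auto)
    finally show ?thesis .
  qed
  with lim show ?thesis
    unfolding closure_sequential by (intro exI[of _ "\<lambda>n. prime_prod U * prime_prod (S n)"]) simp
qed

theorem theorem5p6:
  shows "closure D2 =
    {6 / pi^2..2/3} \<union> {27 / (4 * pi^2)..3/4} \<union> {8 / pi^2..8/9} \<union> {9 / pi^2..1}"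
    (is "_ = ?R")
proof (rule antisym)
  have vals: "prime_prod {} = 1" "prime_prod {2} = 3/4" "prime_prod {3} = 8/9"
    "prime_prod {2, 3} = 2/3"
    by (simp_all add: prime_prod_def)
  have pi: "9 / pi^2 \<le> 1"
    using tail_prod_le_1[of 5] by (simp add: tail_prod_5)
  show "closure D2 \<subseteq> ?R"
  proof (rule closure_minimal)
    show "D2 \<subseteq> ?R"
    proof
      fix x assume "x \<in> D2"
      then show "x \<in> ?R"
      proof (cases rule: D2_cases)
        case zero
        moreover have "6 / pi^2 = 2/3 * (9 / pi^2)" by simp
        ultimately have "6 / pi^2 \<le> x" "x \<le> 2/3" using pi by linarith+
        then show ?thesis by simp
      next
        case (fin S)
        \<comment> \<open>The part of the product from primes at least 5 lies in
          \<open>[9 / pi^2, 1]\<close>; the four choices of \<open>S \<inter> {2, 3}\<close> scale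
          this interval to the four of the claim.\<close>
        define y where "y = prime_prod (S - {2, 3})"
        have "tail_prod 5 \<le> y"
          unfolding y_def
        proof (rule tail_prod_le_prime_prod)
          fix p assume p: "p \<in> S - {2, 3}"
          then have "prime p" using fin(2) by auto
          then have "p \<noteq> 4" by (auto intro!: notI)
          then show "prime p \<and> 5 \<le> p" using p prime_ge_2_nat[of p] \<open>prime p\<close> by auto
        qed (use fin in auto)
        then have y: "9 / pi^2 \<le> y" by (simp add: tail_prod_5)
        have "y \<le> prime_prod {}"
          unfolding y_def using fin by (intro prime_prod_antimono) auto
        then have y1: "y \<le> 1" by (simp add: vals)
        have "x = prime_prod (S \<inter> {2, 3}) * y"
          unfolding fin(3) y_def prime_prod_def using fin(1)
          by (rule prod.Int_Diff)
        moreover have "S \<inter> {2, 3} \<in> {{}, {2}, {3}, {2, 3}}" by auto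
        ultimately have "x = y \<or> x = 3/4 * y \<or> x = 8/9 * y \<or> x = 2/3 * y"
          using vals by auto
        then show ?thesis using y y1 by auto
      qed
    qed
    show "closed ?R" by (intro closed_Un closed_atLeastAtMost)
  qed
  have scaled: "prime_prod U * x \<in> closure D2"
    if "U \<subseteq> {2, 3}" "9 / pi^2 \<le> x" "x \<le> 1" for U x
    using that by (rule scaled_interval_subset_closure)
  show "?R \<subseteq> closure D2"
  proof
    fix x assume "x \<in> ?R"
    then consider "x \<in> {6 / pi^2..2/3}" | "x \<in> {27 / (4 * pi^2)..3/4}"
      | "x \<in> {8 / pi^2..8/9}" | "x \<in> {9 / pi^2..1}" by blast
    then show "x \<in> closure D2"
    proof cases
      case 1
      \<comment> \<open>In each case \<open>x\<close> is divided by \<open>prime_prod U\<close>,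
        which moves it back into \<open>[9 / pi^2, 1]\<close>.\<close>
      then show ?thesis using scaled[of "{2, 3}" "3/2 * x"] by (simp add: vals)
    next
      case 2
      then show ?thesis using scaled[of "{2}" "4/3 * x"] by (simp add: vals)
    next
      case 3
      then show ?thesis using scaled[of "{3}" "9/8 * x"] by (simp add: vals)
    next
      case 4
      then show ?thesis using scaled[of "{}" x] by (simp add: vals)
    qed
  qed
qed

end
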